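(* Let $p_1,p_2,p_3\ge 0$ with $p_1+p_2+p_3=1$. Let $P$ be the $N\times N$ transition matrix of the random walk on the circle with $N$ vertices $\{0,1,\dots,N-1\}$ (indices modulo $N$) which at each step moves from $i$ to $i-1$ with probability $p_1$, moves from $i$ to $i+1$ with probability $p_2$, and stays at $i$ with probability $p_3$. Let $L=I-PP^T$, with eigenvalues $\lambda_0,\dots,\lambda_{N-1}$ listed with multiplicity. If two walkers perform independent random walks with transition matrix $P$, with initial positions independent and uniformly distributed on the circle, and $\tau$ is their meeting time, then $$\mathbf{E}[\tau]=\sum_{i:\,\lambda_i\neq 0}\lambda_i^{-1}.$$
   Context: Time is discrete and in each time slot both walkers move simultaneously and independently, each according to $P$, where $P(i,j)$ is the probability that a walker at vertex $i$ moves to vertex $j$. The meeting time $\tau$ is the first time $t\ge 0$ at which the two walkers are at the same vertex (so $\tau=0$ if they start at the same vertex). $I$ is the $N\times N$ identity matrix and $P^T$ is the transpose of $P$.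
   Formalization: Unless N=1, it is assumed that p_1, p_2, p_3 are all less than 1 and that p_3>0 or N is odd; in every excluded case the walkers may never meet, so E[τ] is infinite while the sum of inverse nonzero eigenvalues is finite. *)

theory Defs
  imports "HOL-Probability.Probability" "Jordan_Normal_Form.Char_Poly"
begin

definition circle_walk_matrix :: "nat \<Rightarrow> real \<Rightarrow> real \<Rightarrow> real \<Rightarrow> real mat" where
  "circle_walk_matrix N p1 p2 p3 = mat N N (\<lambda>(i, j).
     p1 * of_bool (j = (i + N - 1) mod N) +
     p2 * of_bool (j = (i + 1) mod N) +
     p3 * of_bool (j = i))"

definition circle_laplacian :: "nat \<Rightarrow> real mat \<Rightarrow> real mat" where
  "circle_laplacian N P = 1\<^sub>m N - P * transpose_mat P"

text \<open>
  A Markov chain on the states below \<open>N\<close> with transition matrix \<open>P\<close> and uniform initial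
  distribution. The transition condition is restricted to histories of positive probability,
  since conditioning on a null event gives 0 in HOL.
\<close>

definition uniform_markov_chain ::
    "'w measure \<Rightarrow> nat \<Rightarrow> real mat \<Rightarrow> (nat \<Rightarrow> 'w \<Rightarrow> nat) \<Rightarrow> bool" where
  "uniform_markov_chain M N P X \<longleftrightarrow>
     (\<forall>t. X t \<in> measurable M (count_space {..<N})) \<and>
     (\<forall>i<N. \<P>(\<omega> in M. X 0 \<omega> = i) = 1 / real N) \<and>
     (\<forall>t x. \<forall>j<N. (\<forall>s\<le>t. x s < N) \<longrightarrow>
        \<P>(\<omega> in M. \<forall>s\<le>t. X s \<omega> = x s) > 0 \<longrightarrow>
        \<P>(\<omega> in M. X (Suc t) \<omega> = j \<bar> \<forall>s\<le>t. X s \<omega> = x s) = P $$ (x t, j))"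

text \<open>
  Independence of the two walks is independence of the whole trajectories, as random elements
  of the product space; it includes independence of the initial positions.
\<close>

definition independent_walks ::
    "'w measure \<Rightarrow> nat \<Rightarrow> (nat \<Rightarrow> 'w \<Rightarrow> nat) \<Rightarrow> (nat \<Rightarrow> 'w \<Rightarrow> nat) \<Rightarrow> bool" where
  "independent_walks M N X Y \<longleftrightarrow>
     prob_space.indep_var M
       (\<Pi>\<^sub>M t\<in>(UNIV :: nat set). count_space {..<N}) (\<lambda>\<omega> t. X t \<omega>)
       (\<Pi>\<^sub>M t\<in>(UNIV :: nat set). count_space {..<N}) (\<lambda>\<omega> t. Y t \<omega>)"

text \<open>The infimum of the empty set is \<open>\<infinity>\<close>: the meeting time is infinite if the walks never meet.\<close>

definition meeting_time :: "(nat \<Rightarrow> 'w \<Rightarrow> nat) \<Rightarrow> (nat \<Rightarrow> 'w \<Rightarrow> nat) \<Rightarrow> 'w \<Rightarrow> enat" where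
  "meeting_time X Y \<omega> = Inf (enat ` {t. X t \<omega> = Y t \<omega>})"

definition expected_meeting_time ::
    "'w measure \<Rightarrow> (nat \<Rightarrow> 'w \<Rightarrow> nat) \<Rightarrow> (nat \<Rightarrow> 'w \<Rightarrow> nat) \<Rightarrow> ennreal" where
  "expected_meeting_time M X Y = (\<integral>\<^sup>+ \<omega>. ennreal_of_enat (meeting_time X Y \<omega>) \<partial>M)"

end

(* Let tau > t mean that the walkers have not met up to time t. If G vanishes on the diagonal and
   drops by 1 on average in one step of the pair walk started off the diagonal, then
   E[G(X_t, Y_t); tau > t] decreases by P(tau > t) in each step, and summing over t shows that
   E[tau] is the average of G over the starting pairs.

   On the circle the characters chi_k(x) = exp(2 pi i k x / N) diagonalise P, with eigenvalues
   phi_k, hence also I - P P^T, with eigenvalues lambda_k = 1 - |phi_k|^2. Expanding in characters gives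
   G(i, j) = (sum over 0 < k < N of (1 - Re chi_k(i - j)) / lambda_k),
   whose average over all pairs (i, j) is the sum of the inverses of lambda_k for 0 < k < N. *)
theory Submission
  imports Defs
begin

subsection \<open>Fourier analysis on the circle\<close>

text \<open>The integer argument is frequency times position, so that differences of vertices and
  negated frequencies need no reduction modulo \<open>N\<close>.\<close>

definition circle_char :: "nat \<Rightarrow> int \<Rightarrow> complex" where
  "circle_char N a = cis (2 * pi * real_of_int a / real N)"

lemma circle_char_0 [simp]: "circle_char N 0 = 1"
  by (simp add: circle_char_def)

lemma circle_char_add: "circle_char N (a + b) = circle_char N a * circle_char N b"
  by (simp add: circle_char_def cis_mult distrib_left add_divide_distrib)

lemma circle_char_minus: "circle_char N (- a) = cnj (circle_char N a)"
  by (simp add: circle_char_def cis_cnj)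

lemma circle_char_diff: "circle_char N (a - b) = circle_char N a * cnj (circle_char N b)"
  using circle_char_add[of N a "- b"] by (simp add: circle_char_minus)

lemma norm_circle_char [simp]: "norm (circle_char N a) = 1"
  by (simp add: circle_char_def)

lemma circle_char_power: "circle_char N a ^ n = circle_char N (a * int n)"
  unfolding circle_char_def Complex.DeMoivre by (rule arg_cong[of _ _ cis]) simp

lemma circle_char_eq_1_iff:
  assumes "N \<ge> 1"
  shows "circle_char N a = 1 \<longleftrightarrow> int N dvd a"
proof
  assume "circle_char N a = 1"
  then have "cos (2 * pi * real_of_int a / real N) = 1"
    by (simp add: circle_char_def complex_eq_iff)
  then obtain n where "2 * pi * real_of_int a / real N = real_of_int n * 2 * pi"
    unfolding cos_one_2pi_int by blast
  then have "real_of_int a = real_of_int (n * int N)"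
    using assms by (simp add: field_simps)
  then have "a = n * int N"
    by linarith
  then show "int N dvd a" by simp
next
  assume "int N dvd a"
  then obtain n where "a = int N * n" by auto
  then show "circle_char N a = 1"
    using assms cis_multiple_2pi[of "real_of_int n"] by (simp add: circle_char_def mult.assoc)
qed

lemma circle_char_cong:
  assumes "N \<ge> 1" "int N dvd a - b"
  shows "circle_char N a = circle_char N b"
  using circle_char_eq_1_iff[of N "a - b"] circle_char_add[of N "a - b" b] assms by simp

text \<open>A geometric sum whose ratio is an \<open>N\<close>-th root of unity: unless the ratio is
  1, the numerator of the closed form vanishes.\<close>

lemma sum_circle_char:
  assumes "N \<ge> 1"
  shows "(\<Sum>n<N. circle_char N (a * int n)) = (if int N dvd a then of_nat N else 0)"
proof (cases "int N dvd a")
  case True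
  then have "circle_char N (a * int n) = 1" for n
    using assms by (simp add: circle_char_eq_1_iff)
  then show ?thesis using True by simp
next
  case False
  have "circle_char N a \<noteq> 1"
    using False assms by (simp add: circle_char_eq_1_iff)
  moreover have "circle_char N (a * int N) = 1"
    using assms by (simp add: circle_char_eq_1_iff)
  ultimately have "(\<Sum>n<N. circle_char N a ^ n) = 0"
    by (subst sum_gp_strict) (simp add: circle_char_power)
  then show ?thesis
    using False by (simp add: circle_char_power)
qed

text \<open>Two vertices differ by less than \<open>N\<close>, so \<open>N\<close> divides their
  difference only when they coincide. This orthogonality inverts the Fourier matrix and also
  produces the unit drop of the potential.\<close>

lemma sum_circle_char_index:
  assumes "N \<ge> 1" "i < N" "j < N"
  shows "(\<Sum>n<N. circle_char N (int n * (int i - int j))) = (if i = j then of_nat N else 0)"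
proof -
  have "int N dvd int i - int j \<longleftrightarrow> i = j"
    using assms by (auto dest: zdvd_imp_le simp: zdvd_not_zless mod_eq_dvd_iff[symmetric])
  then show ?thesis
    using sum_circle_char[OF assms(1), of "int i - int j"] by (simp add: mult.commute)
qed

section \<open>The characteristic function of one step and the action of the transition matrix on
  characters\<close>

definition step_char :: "nat \<Rightarrow> real \<Rightarrow> real \<Rightarrow> real \<Rightarrow> int \<Rightarrow> complex" where
  "step_char N p1 p2 p3 k =
     of_real p1 * circle_char N (- k) + of_real p2 * circle_char N k + of_real p3"

lemma step_char_swap: "step_char N p2 p1 p3 k = cnj (step_char N p1 p2 p3 k)"
  by (simp add: step_char_def circle_char_minus add_ac)

lemma dim_circle_walk_matrix [simp]:
  "dim_row (circle_walk_matrix N p1 p2 p3) = N" "dim_col (circle_walk_matrix N p1 p2 p3) = N"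
  "circle_walk_matrix N p1 p2 p3 \<in> carrier_mat N N"
  by (simp_all add: circle_walk_matrix_def)

lemma circle_walk_matrix_index:
  assumes "i < N" "j < N"
  shows "circle_walk_matrix N p1 p2 p3 $$ (i, j) =
     p1 * of_bool (j = (i + N - 1) mod N) + p2 * of_bool (j = (i + 1) mod N) + p3 * of_bool (j = i)"
  using assms by (simp add: circle_walk_matrix_def)

text \<open>A shift by one vertex multiplies a character by a constant, and the walk combines such
  shifts linearly; so every character is an eigenvector.\<close>

lemma sum_circle_walk_matrix_char:
  assumes "N \<ge> 1" "i < N"
  shows "(\<Sum>j<N. of_real (circle_walk_matrix N p1 p2 p3 $$ (i, j)) * circle_char N (k * int j)) =
     step_char N p1 p2 p3 k * circle_char N (k * int i)"
proof -
  have delta: "(\<Sum>j<N. of_real (p * of_bool (j = m)) * circle_char N (k * int j)) =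
      of_real p * circle_char N (k * int m)" if "m < N" for p :: real and m
    using that by (subst sum.remove[of _ m]) auto
  have "int ((i + N - 1) mod N) = (int i + int N - 1) mod int N"
    using assms by (simp add: zmod_int of_nat_diff)
  then have "int N dvd int ((i + N - 1) mod N) - (int i + int N - 1)"
    by (simp add: mod_eq_dvd_iff[symmetric])
  \<comment> \<open>The left neighbour is encoded with an extra \<open>N\<close> that keeps the
    subtraction of naturals from being truncated at \<open>i = 0\<close>; adding \<open>N\<close>
    cancels it and leaves the shift by -1.\<close>
  then have "int N dvd int ((i + N - 1) mod N) - (int i + int N - 1) + int N"
    by (rule dvd_add) simp
  then have "int N dvd k * (int ((i + N - 1) mod N) - (int i + int N - 1) + int N)"
    by (rule dvd_mult)
  then have left: "circle_char N (k * int ((i + N - 1) mod N)) = circle_char N (- k + k * int i)"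
    by (intro circle_char_cong[OF assms(1)]) (simp add: algebra_simps)
  have "int N dvd int ((i + 1) mod N) - (int i + 1)"
    by (simp add: mod_eq_dvd_iff[symmetric] zmod_int add_ac)
  then have "int N dvd k * (int ((i + 1) mod N) - (int i + 1))"
    by (rule dvd_mult)
  then have right: "circle_char N (k * int ((i + 1) mod N)) = circle_char N (k + k * int i)"
    by (intro circle_char_cong[OF assms(1)]) (simp add: algebra_simps)
  have "(\<Sum>j<N. of_real (circle_walk_matrix N p1 p2 p3 $$ (i, j)) * circle_char N (k * int j)) =
     (\<Sum>j<N. of_real (p1 * of_bool (j = (i + N - 1) mod N)) * circle_char N (k * int j)) +
     (\<Sum>j<N. of_real (p2 * of_bool (j = (i + 1) mod N)) * circle_char N (k * int j)) +
     (\<Sum>j<N. of_real (p3 * of_bool (j = i)) * circle_char N (k * int j))"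
    unfolding sum.distrib[symmetric] using assms
    by (intro sum.cong) (auto simp: circle_walk_matrix_index algebra_simps)
  also have "\<dots> = of_real p1 * circle_char N (k * int ((i + N - 1) mod N)) +
      of_real p2 * circle_char N (k * int ((i + 1) mod N)) + of_real p3 * circle_char N (k * int i)"
    using assms by (subst (1 2 3) delta) auto
  also have "\<dots> = step_char N p1 p2 p3 k * circle_char N (k * int i)"
    unfolding left right circle_char_add by (simp add: step_char_def algebra_simps)
  finally show ?thesis .
qed

text \<open>Transposition reverses every step and so exchanges \<open>p1\<close> and
  \<open>p2\<close>. The transpose is again a circle walk, and by \<open>step_char_swap\<close> its
  eigenvalues are the conjugates.\<close>

lemma transpose_circle_walk_matrix:
  "transpose_mat (circle_walk_matrix N p1 p2 p3) = circle_walk_matrix N p2 p1 p3"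
proof (rule eq_matI)
  fix i j assume "i < dim_row (circle_walk_matrix N p2 p1 p3)"
    "j < dim_col (circle_walk_matrix N p2 p1 p3)"
  then have ij: "i < N" "j < N" by simp_all
  have *: "b = (a + 1) mod N \<longleftrightarrow> a = (b + N - 1) mod N" if "a < N" "b < N" for a b
    using that by (auto simp: mod_if)
  show "transpose_mat (circle_walk_matrix N p1 p2 p3) $$ (i, j) = circle_walk_matrix N p2 p1 p3 $$ (i, j)"
    using ij *[of i j] *[of j i] by (auto simp: circle_walk_matrix_index)
qed simp_all

section \<open>Diagonalisation of the Laplacian by the Fourier matrix\<close>

definition walk_eigenvalue :: "nat \<Rightarrow> real \<Rightarrow> real \<Rightarrow> real \<Rightarrow> nat \<Rightarrow> real" where
  "walk_eigenvalue N p1 p2 p3 k = 1 - (norm (step_char N p1 p2 p3 (int k)))\<^sup>2"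

definition fourier_matrix :: "nat \<Rightarrow> complex mat" where
  "fourier_matrix N = mat N N (\<lambda>(i, k). circle_char N (int k * int i))"

definition inv_fourier_matrix :: "nat \<Rightarrow> complex mat" where
  "inv_fourier_matrix N = mat N N (\<lambda>(k, i). cnj (circle_char N (int k * int i)) / of_nat N)"

lemma fourier_matrix_carrier [simp]:
  "fourier_matrix N \<in> carrier_mat N N" "inv_fourier_matrix N \<in> carrier_mat N N"
  by (simp_all add: fourier_matrix_def inv_fourier_matrix_def)

lemma fourier_matrix_inverse:
  assumes "N \<ge> 1"
  shows "fourier_matrix N * inv_fourier_matrix N = 1\<^sub>m N"
    and "inv_fourier_matrix N * fourier_matrix N = 1\<^sub>m N"
proof -
  show *: "fourier_matrix N * inv_fourier_matrix N = 1\<^sub>m N"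
  proof (rule eq_matI)
    fix i j assume "i < dim_row (1\<^sub>m N :: complex mat)" "j < dim_col (1\<^sub>m N :: complex mat)"
    then have ij: "i < N" "j < N" by simp_all
    have "(fourier_matrix N * inv_fourier_matrix N) $$ (i, j) =
        (\<Sum>k<N. circle_char N (int k * int i) * (cnj (circle_char N (int k * int j)) / of_nat N))"
      using ij by (simp add: fourier_matrix_def inv_fourier_matrix_def scalar_prod_def atLeast0LessThan)
    also have "\<dots> = (\<Sum>k<N. circle_char N (int k * (int i - int j))) / of_nat N"
      by (simp add: sum_divide_distrib right_diff_distrib circle_char_diff)
    also have "\<dots> = (1\<^sub>m N :: complex mat) $$ (i, j)"
      using ij assms by (subst sum_circle_char_index) auto
    finally show "(fourier_matrix N * inv_fourier_matrix N) $$ (i, j) = (1\<^sub>m N :: complex mat) $$ (i, j)" .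
  qed (simp_all add: fourier_matrix_def inv_fourier_matrix_def)
  show "inv_fourier_matrix N * fourier_matrix N = 1\<^sub>m N"
    by (rule mat_mult_left_right_inverse[OF _ _ *]) simp_all
qed

text \<open>The columns of the Fourier matrix are the character eigenvectors, whatever the weights;
  hence one matrix serves both \<open>P\<close> and its transpose.\<close>

lemma circle_walk_matrix_mult_fourier:
  assumes "N \<ge> 1"
  shows "map_mat complex_of_real (circle_walk_matrix N p1 p2 p3) * fourier_matrix N =
    fourier_matrix N * mat_diag N (\<lambda>k. step_char N p1 p2 p3 (int k))"
proof (rule eq_matI)
  fix i k
  assume "i < dim_row (fourier_matrix N * mat_diag N (\<lambda>k. step_char N p1 p2 p3 (int k)))"
    "k < dim_col (fourier_matrix N * mat_diag N (\<lambda>k. step_char N p1 p2 p3 (int k)))"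
  then have ik: "i < N" "k < N" by (simp_all add: fourier_matrix_def mat_diag_def)
  have "(map_mat complex_of_real (circle_walk_matrix N p1 p2 p3) * fourier_matrix N) $$ (i, k) =
      (\<Sum>j<N. of_real (circle_walk_matrix N p1 p2 p3 $$ (i, j)) * circle_char N (int k * int j))"
    using ik by (simp add: fourier_matrix_def scalar_prod_def atLeast0LessThan)
  also have "\<dots> = (fourier_matrix N * mat_diag N (\<lambda>k. step_char N p1 p2 p3 (int k))) $$ (i, k)"
    using ik assms
    by (subst mat_diag_mult_right[of _ N])
       (simp_all add: sum_circle_walk_matrix_char fourier_matrix_def mult.commute[of "step_char N p1 p2 p3 (int k)"])
  finally show "(map_mat complex_of_real (circle_walk_matrix N p1 p2 p3) * fourier_matrix N) $$ (i, k) =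
    (fourier_matrix N * mat_diag N (\<lambda>k. step_char N p1 p2 p3 (int k))) $$ (i, k)" .
qed (simp_all add: fourier_matrix_def mat_diag_def)

text \<open>Conjugation by the Fourier matrix turns the Laplacian into a diagonal matrix. Similar
  matrices share the characteristic polynomial, which gives the eigenvalues with their
  multiplicities.\<close>

lemma char_poly_circle_laplacian:
  assumes N: "N \<ge> 1"
  shows "char_poly (map_mat complex_of_real (circle_laplacian N (circle_walk_matrix N p1 p2 p3))) =
    (\<Prod>k<N. [:- complex_of_real (walk_eigenvalue N p1 p2 p3 k), 1:])"
proof -
  let ?F = "fourier_matrix N" and ?G = "inv_fourier_matrix N"
  let ?C = "map_mat complex_of_real"
  let ?P = "circle_walk_matrix N p1 p2 p3" and ?Q = "circle_walk_matrix N p2 p1 p3"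
  let ?S = "\<lambda>k. step_char N p1 p2 p3 (int k)" and ?T = "\<lambda>k. step_char N p2 p1 p3 (int k)"
  let ?D = "mat_diag N (\<lambda>k. complex_of_real (walk_eigenvalue N p1 p2 p3 k))"
  note carr = fourier_matrix_carrier[of N] mat_diag_dim[of N]
  have C: "?C ?P \<in> carrier_mat N N" "?C ?Q \<in> carrier_mat N N" by simp_all
  have L: "?C (circle_laplacian N ?P) = 1\<^sub>m N - ?C ?P * ?C ?Q"
  proof -
    have "?C (?P * ?Q) = ?C ?P * ?C ?Q"
      by (rule of_real_hom.mat_hom_mult[of _ N N _ N]) simp_all
    then show ?thesis
      unfolding circle_laplacian_def transpose_circle_walk_matrix
      by (auto simp flip: \<open>?C (?P * ?Q) = ?C ?P * ?C ?Q\<close> intro!: eq_matI)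
  qed
  \<comment> \<open>\<open>?T k\<close> is the conjugate of \<open>?S k\<close>, so the product is a
    squared norm and the eigenvalue is real.\<close>
  have ST: "1 - ?S k * ?T k = complex_of_real (walk_eigenvalue N p1 p2 p3 k)" for k
    unfolding step_char_swap[of N p2] walk_eigenvalue_def
    by (simp add: complex_norm_square[symmetric])
  have "?C ?P * ?C ?Q * ?F = ?C ?P * (?C ?Q * ?F)"
    by (rule assoc_mult_mat[OF C carr(1)])
  also have "?C ?Q * ?F = ?F * mat_diag N ?T"
    by (rule circle_walk_matrix_mult_fourier[OF N])
  also have "?C ?P * (?F * mat_diag N ?T) = (?C ?P * ?F) * mat_diag N ?T"
    by (rule assoc_mult_mat[symmetric, OF C(1) carr(1,3)])
  also have "\<dots> = ?F * mat_diag N ?S * mat_diag N ?T"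
    by (simp add: circle_walk_matrix_mult_fourier[OF N])
  also have "\<dots> = ?F * (mat_diag N ?S * mat_diag N ?T)"
    by (rule assoc_mult_mat[OF carr(1,3,3)])
  finally have PQF: "?C ?P * ?C ?Q * ?F = ?F * mat_diag N (\<lambda>k. ?S k * ?T k)"
    by simp
  have D: "?D = 1\<^sub>m N - mat_diag N (\<lambda>k. ?S k * ?T k)"
    by (rule eq_matI) (auto simp: mat_diag_def ST[symmetric])
  have LF: "?C (circle_laplacian N ?P) * ?F = ?F * ?D"
  proof -
    have "?C (circle_laplacian N ?P) * ?F = 1\<^sub>m N * ?F - ?C ?P * ?C ?Q * ?F"
      unfolding L by (rule minus_mult_distrib_mat[of _ N N _ _ N]) (use C carr in auto)
    also have "\<dots> = ?F * 1\<^sub>m N - ?F * mat_diag N (\<lambda>k. ?S k * ?T k)"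
      by (simp only: PQF left_mult_one_mat[OF carr(1)] right_mult_one_mat[OF carr(1)])
    also have "\<dots> = ?F * ?D"
      unfolding D by (rule mult_minus_distrib_mat[symmetric, of _ N N _ N]) (use carr in auto)
    finally show ?thesis .
  qed
  have Lc: "?C (circle_laplacian N ?P) \<in> carrier_mat N N"
    unfolding L by auto
  have "?F * ?D * ?G = ?C (circle_laplacian N ?P) * ?F * ?G"
    by (simp add: LF)
  also have "\<dots> = ?C (circle_laplacian N ?P) * (?F * ?G)"
    by (rule assoc_mult_mat[OF Lc carr(1,2)])
  also have "\<dots> = ?C (circle_laplacian N ?P)"
    using Lc by (simp add: fourier_matrix_inverse[OF N])
  finally have "similar_mat (?C (circle_laplacian N ?P)) ?D"
    using Lc fourier_matrix_inverse[OF N] by (intro similar_matI[of _ _ ?F ?G N]) auto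
  then have "char_poly (?C (circle_laplacian N ?P)) = char_poly ?D"
    by (rule char_poly_similar)
  also have "\<dots> = (\<Prod>a\<leftarrow>diag_mat ?D. [:- a, 1:])"
    by (rule char_poly_upper_triangular[of _ N]) (auto simp: mat_diag_def upper_triangular_def)
  also have "\<dots> = (\<Prod>k<N. [:- complex_of_real (walk_eigenvalue N p1 p2 p3 k), 1:])"
    by (simp add: diag_mat_def mat_diag_def prod.list_conv_set_nth atLeast0LessThan)
  finally show ?thesis .
qed

text \<open>A product of monic linear factors determines the multiset of its roots. This allows an
  arbitrary listing of the eigenvalues to be replaced by the explicit one.\<close>

lemma linear_factors_sum_eq:
  fixes a b :: "'i \<Rightarrow> 'a :: field" and h :: "'a \<Rightarrow> 'b :: comm_monoid_add"
  assumes "(\<Prod>i\<in>I. [:- a i, 1:]) = (\<Prod>i\<in>J. [:- b i, 1:])"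
  shows "(\<Sum>i\<in>I. h (a i)) = (\<Sum>i\<in>J. h (b i))"
proof -
  have proots: "proots (\<Prod>i\<in>K. [:- c i, 1:]) = image_mset c (mset_set K)"
    for c :: "'i \<Rightarrow> 'a" and K
    by (subst proots_prod) (simp_all add: sum_unfold_sum_mset)
  have "image_mset a (mset_set I) = image_mset b (mset_set J)"
    using arg_cong[OF assms, of proots] unfolding proots .
  then have "sum_mset (image_mset h (image_mset a (mset_set I))) =
      sum_mset (image_mset h (image_mset b (mset_set J)))"
    by simp
  then show ?thesis
    by (simp add: sum_unfold_sum_mset multiset.map_comp comp_def)
qed

subsection \<open>The potential\<close>

text \<open>For nonnegative weights both summands of this form are nonnegative, so positivity can be
  checked on one of them.\<close>

lemma walk_eigenvalue_eq:
  assumes p: "p1 + p2 + p3 = 1"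
  shows "walk_eigenvalue N p1 p2 p3 k =
    4 * p1 * p2 * (1 - (Re (circle_char N (int k)))\<^sup>2) +
    2 * p3 * (p1 + p2) * (1 - Re (circle_char N (int k)))"
proof -
  define c s where "c = Re (circle_char N (int k))" and "s = Im (circle_char N (int k))"
  have cs: "s\<^sup>2 = 1 - c\<^sup>2"
    using norm_circle_char[of N "int k"] by (simp add: cmod_def c_def s_def)
  have "(norm (step_char N p1 p2 p3 (int k)))\<^sup>2 = ((p1 + p2) * c + p3)\<^sup>2 + (p2 - p1)\<^sup>2 * s\<^sup>2"
    unfolding cmod_power2 step_char_def circle_char_minus
    by (simp add: c_def[symmetric] s_def[symmetric] power2_eq_square algebra_simps)
  moreover have "p3 = 1 - p1 - p2" using p by simp
  ultimately show ?thesis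
    unfolding walk_eigenvalue_def c_def[symmetric] cs
    by (simp add: power2_eq_square) (simp add: algebra_simps)
qed

lemma walk_eigenvalue_0:
  assumes "p1 + p2 + p3 = 1"
  shows "walk_eigenvalue N p1 p2 p3 0 = 0"
  using walk_eigenvalue_eq[OF assms, of N 0] by simp

text \<open>If \<open>p3 > 0\<close>, the second summand is positive because \<open>z\<close> is not
  1 and \<open>p1 + p2 > 0\<close>. If \<open>p3 = 0\<close>, then \<open>p1\<close> and
  \<open>p2\<close> are both positive and the first summand vanishes only at \<open>z = 1\<close> or
  \<open>z = -1\<close>; odd \<open>N\<close> rules out the latter.\<close>

lemma walk_eigenvalue_pos:
  assumes p: "p1 \<ge> 0" "p2 \<ge> 0" "p3 \<ge> 0" "p1 + p2 + p3 = 1"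
    and nondeg: "p1 < 1" "p2 < 1" "p3 < 1" "p3 > 0 \<or> odd N"
    and k: "0 < k" "k < N"
  shows "walk_eigenvalue N p1 p2 p3 k > 0"
proof -
  define z where "z = circle_char N (int k)"
  have norm_z: "(Re z)\<^sup>2 + (Im z)\<^sup>2 = 1"
    using norm_circle_char[of N "int k"] by (simp add: z_def cmod_def)
  then have sq_le: "(Re z)\<^sup>2 \<le> 1"
    by (smt (verit) zero_le_power2)
  then have re_le: "Re z \<le> 1"
    by (simp add: abs_square_le_1)
  have eq: "walk_eigenvalue N p1 p2 p3 k =
      4 * p1 * p2 * (1 - (Re z)\<^sup>2) + 2 * p3 * (p1 + p2) * (1 - Re z)"
    unfolding z_def by (rule walk_eigenvalue_eq[OF p(4)])
  have nonneg: "0 \<le> 4 * p1 * p2 * (1 - (Re z)\<^sup>2)" "0 \<le> 2 * p3 * (p1 + p2) * (1 - Re z)"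
    using p sq_le re_le by simp_all
  show ?thesis
  proof (cases "p3 > 0")
    case True
    have "\<not> int N dvd int k"
      using k by (simp add: nat_dvd_not_less)
    then have "z \<noteq> 1"
      using k by (simp add: z_def circle_char_eq_1_iff)
    then have "Re z \<noteq> 1"
      using norm_z by (auto simp: complex_eq_iff)
    then have "0 < 2 * p3 * (p1 + p2) * (1 - Re z)"
      using re_le True p nondeg by (intro mult_pos_pos) auto
    then show ?thesis
      using nonneg eq by linarith
  next
    case False
    then have "coprime N 2" and p3: "p3 = 0"
      using nondeg p by auto
    \<comment> \<open>The square of \<open>z\<close> is the character at \<open>2 * k\<close>, so
      this excludes both square roots of 1 at once.\<close>
    have "\<not> N dvd 2 * k"
      using k \<open>coprime N 2\<close> by (auto simp: coprime_dvd_mult_right_iff nat_dvd_not_less)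
    then have "\<not> int N dvd int k * int 2"
      by (metis int_dvd_int_iff mult.commute of_nat_mult)
    then have "z\<^sup>2 \<noteq> 1"
      unfolding z_def circle_char_power using k by (simp add: circle_char_eq_1_iff)
    then have "(Re z)\<^sup>2 \<noteq> 1"
      using norm_z by (auto simp: complex_eq_iff power2_eq_square)
    then have "0 < 4 * p1 * p2 * (1 - (Re z)\<^sup>2)"
      using sq_le p3 p nondeg by (intro mult_pos_pos) auto
    then show ?thesis
      using nonneg eq by linarith
  qed
qed

section \<open>The potential, its one-step drop and its average\<close>

definition meeting_potential :: "nat \<Rightarrow> real \<Rightarrow> real \<Rightarrow> real \<Rightarrow> nat \<Rightarrow> nat \<Rightarrow> real" where
  "meeting_potential N p1 p2 p3 i j =
     (\<Sum>k=1..<N. (1 - Re (circle_char N (int k * (int i - int j)))) / walk_eigenvalue N p1 p2 p3 k)"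

lemma meeting_potential_diag [simp]: "meeting_potential N p1 p2 p3 i i = 0"
  by (simp add: meeting_potential_def)

lemma meeting_potential_nonneg:
  assumes "\<And>k. 0 < k \<Longrightarrow> k < N \<Longrightarrow> walk_eigenvalue N p1 p2 p3 k > 0"
  shows "meeting_potential N p1 p2 p3 i j \<ge> 0"
  unfolding meeting_potential_def
proof (intro sum_nonneg divide_nonneg_nonneg)
  fix k assume "k \<in> {1..<N}"
  then show "walk_eigenvalue N p1 p2 p3 k \<ge> 0"
    using assms[of k] by auto
  show "1 - Re (circle_char N (int k * (int i - int j))) \<ge> 0"
    using complex_Re_le_cmod[of "circle_char N (int k * (int i - int j))"] by simp
qed

lemma sum_lessThan_shift1:
  fixes f :: "nat \<Rightarrow> 'a :: comm_monoid_add"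
  assumes "N \<ge> 1"
  shows "(\<Sum>k<N. f k) = f 0 + (\<Sum>k=1..<N. f k)"
  using assms by (simp add: sum.atLeast_Suc_lessThan[of 0 N] atLeast0LessThan[symmetric])

text \<open>A character of the difference factors into a character of the first position and a
  conjugate character of the second. The two walkers contribute conjugate eigenvalues of
  \<open>P\<close>, whose product is \<open>1 - walk_eigenvalue N p1 p2 p3 k\<close>.\<close>

lemma sum_circle_walk_matrix_pair:
  fixes p1 p2 p3 :: real
  assumes N: "N \<ge> 1" "i < N" "j < N"
  defines "W \<equiv> circle_walk_matrix N p1 p2 p3"
  shows "(\<Sum>i'<N. \<Sum>j'<N. W $$ (i, i') * W $$ (j, j') * Re (circle_char N (int k * (int i' - int j')))) =
    (1 - walk_eigenvalue N p1 p2 p3 k) * Re (circle_char N (int k * (int i - int j)))"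
proof -
  let ?c = "\<lambda>i. circle_char N (int k * int i)"
  have "(\<Sum>i'<N. \<Sum>j'<N. W $$ (i, i') * W $$ (j, j') * Re (circle_char N (int k * (int i' - int j')))) =
      Re ((\<Sum>i'<N. of_real (W $$ (i, i')) * ?c i') * cnj (\<Sum>j'<N. of_real (W $$ (j, j')) * ?c j'))"
    by (simp add: sum_product right_diff_distrib circle_char_diff algebra_simps)
  also have "\<dots> = Re ((step_char N p1 p2 p3 (int k) * ?c i) * cnj (step_char N p1 p2 p3 (int k) * ?c j))"
    unfolding W_def using N by (subst (1 2) sum_circle_walk_matrix_char) simp_all
  also have "\<dots> = Re (step_char N p1 p2 p3 (int k) * cnj (step_char N p1 p2 p3 (int k)) *
      circle_char N (int k * (int i - int j)))"
    by (rule arg_cong[of _ _ Re]) (simp add: right_diff_distrib circle_char_diff mult_ac)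
  also have "\<dots> = (1 - walk_eigenvalue N p1 p2 p3 k) * Re (circle_char N (int k * (int i - int j)))"
    unfolding walk_eigenvalue_def complex_norm_square[symmetric] by simp
  finally show ?thesis .
qed

text \<open>One step multiplies the character of frequency \<open>k\<close> by one minus the
  eigenvalue, so after division by the eigenvalue the \<open>k\<close>-th term grows by exactly
  \<open>Re chi_k(i - j)\<close>. Over all frequencies these increments sum to 0 off the diagonal,
  and the omitted frequency 0 accounts for 1, leaving -1.\<close>

lemma meeting_potential_step:
  assumes N: "N \<ge> 1" "i < N" "j < N" and "i \<noteq> j"
    and p: "p1 + p2 + p3 = 1"
    and pos: "\<And>k. 0 < k \<Longrightarrow> k < N \<Longrightarrow> walk_eigenvalue N p1 p2 p3 k > 0"
  defines "W \<equiv> circle_walk_matrix N p1 p2 p3"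
  shows "(\<Sum>i'<N. \<Sum>j'<N. W $$ (i, i') * W $$ (j, j') * meeting_potential N p1 p2 p3 i' j') =
    meeting_potential N p1 p2 p3 i j - 1"
proof -
  let ?l = "walk_eigenvalue N p1 p2 p3"
  let ?c = "\<lambda>k i j. Re (circle_char N (int k * (int i - int j)))"
  note pair = sum_circle_walk_matrix_pair[OF N(1), of _ _ p1 p2 p3, folded W_def]
  \<comment> \<open>At frequency 0 the character is constant and the eigenvalue is 0, so the pair
    identity says that the transition weights of the pair sum to 1.\<close>
  have one: "(\<Sum>i'<N. \<Sum>j'<N. W $$ (i, i') * W $$ (j, j')) = 1"
    using pair[OF N(2,3), of 0] by (simp add: walk_eigenvalue_0[OF p])
  have "(\<Sum>i'<N. \<Sum>j'<N. W $$ (i, i') * W $$ (j, j') * meeting_potential N p1 p2 p3 i' j') =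
      (\<Sum>i'<N. \<Sum>j'<N. \<Sum>k=1..<N. W $$ (i, i') * W $$ (j, j') * ((1 - ?c k i' j') / ?l k))"
    by (simp add: meeting_potential_def sum_distrib_left)
  also have "\<dots> = (\<Sum>i'<N. \<Sum>k=1..<N. \<Sum>j'<N. W $$ (i, i') * W $$ (j, j') * ((1 - ?c k i' j') / ?l k))"
    by (rule sum.cong[OF refl], rule sum.swap)
  also have "\<dots> = (\<Sum>k=1..<N. \<Sum>i'<N. \<Sum>j'<N. W $$ (i, i') * W $$ (j, j') * ((1 - ?c k i' j') / ?l k))"
    by (rule sum.swap)
  also have "\<dots> = (\<Sum>k=1..<N. ((\<Sum>i'<N. \<Sum>j'<N. W $$ (i, i') * W $$ (j, j')) -
      (\<Sum>i'<N. \<Sum>j'<N. W $$ (i, i') * W $$ (j, j') * ?c k i' j')) / ?l k)"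
    by (simp add: sum_subtractf[symmetric] sum_divide_distrib right_diff_distrib)
  also have "\<dots> = (\<Sum>k=1..<N. (1 - ?c k i j) / ?l k + ?c k i j)"
  proof (rule sum.cong)
    fix k assume "k \<in> {1..<N}"
    then have "?l k \<noteq> 0" using pos[of k] by auto
    then show "((\<Sum>i'<N. \<Sum>j'<N. W $$ (i, i') * W $$ (j, j')) -
      (\<Sum>i'<N. \<Sum>j'<N. W $$ (i, i') * W $$ (j, j') * ?c k i' j')) / ?l k = (1 - ?c k i j) / ?l k + ?c k i j"
      unfolding one pair[OF N(2,3)] by (simp add: field_simps)
  qed simp
  also have "\<dots> = meeting_potential N p1 p2 p3 i j + (\<Sum>k=1..<N. ?c k i j)"
    by (simp add: sum.distrib meeting_potential_def)
  also have "(\<Sum>k=1..<N. ?c k i j) = -1"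
  proof -
    have "(\<Sum>k<N. ?c k i j) = 0"
      using arg_cong[OF sum_circle_char_index[OF N], of Re] \<open>i \<noteq> j\<close> by simp
    then show ?thesis
      using sum_lessThan_shift1[OF N(1), of "\<lambda>k. ?c k i j"] by simp
  qed
  finally show ?thesis by simp
qed

text \<open>For fixed \<open>j\<close>, the characters of nonzero frequency sum to 0 over
  \<open>i\<close>, so only the constant 1 in each numerator survives.\<close>

lemma sum_meeting_potential:
  assumes N: "N \<ge> 1"
  shows "(\<Sum>i<N. \<Sum>j<N. meeting_potential N p1 p2 p3 i j) =
    (real N)\<^sup>2 * (\<Sum>k=1..<N. 1 / walk_eigenvalue N p1 p2 p3 k)"
proof -
  let ?l = "walk_eigenvalue N p1 p2 p3"
  let ?c = "\<lambda>k i j. Re (circle_char N (int k * (int i - int j)))"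
  have "(\<Sum>i<N. meeting_potential N p1 p2 p3 i j) = real N * (\<Sum>k=1..<N. 1 / ?l k)" for j
  proof -
    have "(\<Sum>i<N. meeting_potential N p1 p2 p3 i j) = (\<Sum>k=1..<N. \<Sum>i<N. (1 - ?c k i j) / ?l k)"
      unfolding meeting_potential_def by (rule sum.swap)
    also have "\<dots> = (\<Sum>k=1..<N. real N / ?l k)"
    proof (rule sum.cong)
      fix k assume k: "k \<in> {1..<N}"
      then have "\<not> int N dvd int k"
        by (simp add: nat_dvd_not_less)
      then have "(\<Sum>i<N. circle_char N (int k * (int i - int j))) = 0"
        using sum_circle_char[OF N, of "int k"]
        by (simp add: right_diff_distrib circle_char_diff sum_distrib_right[symmetric])
      then have "(\<Sum>i<N. ?c k i j) = 0"
        by (metis Re_sum zero_complex.sel(1))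
      then show "(\<Sum>i<N. (1 - ?c k i j) / ?l k) = real N / ?l k"
        by (simp add: sum_divide_distrib[symmetric] sum_subtractf)
    qed simp
    finally show ?thesis
      by (simp add: sum_distrib_left)
  qed
  then show ?thesis
    by (subst sum.swap) (simp add: power2_eq_square)
qed

subsection \<open>Meeting of two independent chains\<close>

text \<open>Expresses the tail events of the meeting time by finitely many positions, as needed for
  the formula that sums tail probabilities.\<close>

lemma meeting_time_gt_iff: "enat t < meeting_time X Y \<omega> \<longleftrightarrow> (\<forall>s\<le>t. X s \<omega> \<noteq> Y s \<omega>)"
proof -
  have "meeting_time X Y \<omega> \<le> enat t \<longleftrightarrow> (\<exists>s\<le>t. X s \<omega> = Y s \<omega>)"
  proof
    assume le: "meeting_time X Y \<omega> \<le> enat t"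
    \<comment> \<open>Without a meeting the infimum would be infinite. A nonempty set in a
      well-order attains its infimum, which supplies the meeting time below
      \<open>t\<close>.\<close>
    have "{s. X s \<omega> = Y s \<omega>} \<noteq> {}"
    proof
      assume "{s. X s \<omega> = Y s \<omega>} = {}"
      with le show False
        unfolding meeting_time_def by (simp only: image_empty Inf_empty top_enat_def) simp
    qed
    then obtain s where "enat s \<in> enat ` {s. X s \<omega> = Y s \<omega>}"
      by blast
    then have "meeting_time X Y \<omega> \<in> enat ` {s. X s \<omega> = Y s \<omega>}"
      unfolding meeting_time_def by (rule wellorder_InfI)
    with le show "\<exists>s\<le>t. X s \<omega> = Y s \<omega>"
      by auto
  next
    assume "\<exists>s\<le>t. X s \<omega> = Y s \<omega>"
    then obtain s where "s \<le> t" "X s \<omega> = Y s \<omega>" by blast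
    then have "meeting_time X Y \<omega> \<le> enat s"
      unfolding meeting_time_def by (intro Inf_lower) auto
    also have "enat s \<le> enat t" using \<open>s \<le> t\<close> by simp
    finally show "meeting_time X Y \<omega> \<le> enat t" .
  qed
  then show ?thesis
    by (auto simp: not_le[symmetric])
qed

text \<open>The matrix \<open>P\<close> is arbitrary here; the circle enters later, through the
  choice of potential.\<close>

locale independent_chains = prob_space M for M :: "'w measure" +
  fixes N :: nat and P :: "real mat" and X Y :: "nat \<Rightarrow> 'w \<Rightarrow> nat"
  assumes chain_X: "uniform_markov_chain M N P X"
    and chain_Y: "uniform_markov_chain M N P Y"
    and indep: "independent_walks M N X Y"
begin

lemma measurable_chain:
  assumes "uniform_markov_chain M N P Z"
  shows "Z t \<in> measurable M (count_space UNIV)" and "\<omega> \<in> space M \<Longrightarrow> Z t \<omega> < N"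
proof -
  have Z: "Z t \<in> measurable M (count_space {..<N})"
    using assms by (simp add: uniform_markov_chain_def)
  show "Z t \<in> measurable M (count_space UNIV)"
    using measurable_compose[OF Z, of "\<lambda>x. x" "count_space UNIV"] by simp
  show "\<omega> \<in> space M \<Longrightarrow> Z t \<omega> < N"
    using measurable_space[OF Z] by simp
qed

lemmas [measurable] = measurable_chain(1)[OF chain_X] measurable_chain(1)[OF chain_Y]
lemmas chain_less = measurable_chain(2)[OF chain_X] measurable_chain(2)[OF chain_Y]

text \<open>Multiplying out the conditional probability removes the positivity condition of the
  Markov property: for a null history both sides are 0.\<close>

lemma prob_history_Suc:
  assumes Z: "uniform_markov_chain M N P Z"
    and x: "\<And>s. s \<le> t \<Longrightarrow> x s < N" and j: "j < N"
  shows "\<P>(\<omega> in M. \<forall>s\<le>Suc t. Z s \<omega> = (x(Suc t := j)) s) =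
    \<P>(\<omega> in M. \<forall>s\<le>t. Z s \<omega> = x s) * P $$ (x t, j)"
proof -
  note [measurable] = measurable_chain(1)[OF Z]
  have eq: "(\<forall>s\<le>Suc t. Z s \<omega> = (x(Suc t := j)) s) \<longleftrightarrow> Z (Suc t) \<omega> = j \<and> (\<forall>s\<le>t. Z s \<omega> = x s)" for \<omega>
    by (auto simp: le_Suc_eq)
  show ?thesis
  proof (cases "\<P>(\<omega> in M. \<forall>s\<le>t. Z s \<omega> = x s) > 0")
    case True
    then have "\<P>(\<omega> in M. Z (Suc t) \<omega> = j \<bar> \<forall>s\<le>t. Z s \<omega> = x s) = P $$ (x t, j)"
      using Z x j by (auto simp: uniform_markov_chain_def)
    then show ?thesis
      using True unfolding eq cond_prob_def by (simp add: field_simps)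
  next
    case False
    then have 0: "\<P>(\<omega> in M. \<forall>s\<le>t. Z s \<omega> = x s) = 0"
      using measure_nonneg[of M] by (simp add: not_less antisym)
    have "\<P>(\<omega> in M. \<forall>s\<le>Suc t. Z s \<omega> = (x(Suc t := j)) s) \<le> \<P>(\<omega> in M. \<forall>s\<le>t. Z s \<omega> = x s)"
      unfolding eq by (rule finite_measure_mono) auto
    then show ?thesis
      using 0 measure_nonneg[of M] by (simp add: antisym)
  qed
qed

text \<open>A history up to \<open>t\<close> is a cylinder set in the space of trajectories, so
  independence of the whole trajectories applies to it.\<close>

lemma prob_joint_history:
  "\<P>(\<omega> in M. (\<forall>s\<le>t. X s \<omega> = x s) \<and> (\<forall>s\<le>t. Y s \<omega> = y s)) =
    \<P>(\<omega> in M. \<forall>s\<le>t. X s \<omega> = x s) * \<P>(\<omega> in M. \<forall>s\<le>t. Y s \<omega> = y s)"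
proof -
  let ?S = "\<Pi>\<^sub>M t\<in>(UNIV :: nat set). count_space {..<N}"
  let ?H = "\<lambda>x. {f \<in> space ?S. \<forall>s\<le>t. f s = (x s :: nat)}"
  have sets: "?H x \<in> sets ?S" for x
    by measurable
  have space: "(\<lambda>t. X t \<omega>) \<in> space ?S" "(\<lambda>t. Y t \<omega>) \<in> space ?S" if "\<omega> \<in> space M" for \<omega>
    using that chain_less by (auto simp: space_PiM)
  have "prob ((\<lambda>\<omega>. (\<lambda>t. X t \<omega>, \<lambda>t. Y t \<omega>)) -` (?H x \<times> ?H y) \<inter> space M) =
      prob ((\<lambda>\<omega> t. X t \<omega>) -` ?H x \<inter> space M) * prob ((\<lambda>\<omega> t. Y t \<omega>) -` ?H y \<inter> space M)"
    using indep unfolding independent_walks_def by (rule indep_varD[OF _ sets sets])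
  moreover have "(\<lambda>\<omega>. (\<lambda>t. X t \<omega>, \<lambda>t. Y t \<omega>)) -` (?H x \<times> ?H y) \<inter> space M =
      {\<omega> \<in> space M. (\<forall>s\<le>t. X s \<omega> = x s) \<and> (\<forall>s\<le>t. Y s \<omega> = y s)}"
    "(\<lambda>\<omega> t. X t \<omega>) -` ?H x \<inter> space M = {\<omega> \<in> space M. \<forall>s\<le>t. X s \<omega> = x s}"
    "(\<lambda>\<omega> t. Y t \<omega>) -` ?H y \<inter> space M = {\<omega> \<in> space M. \<forall>s\<le>t. Y s \<omega> = y s}"
    using space by auto
  ultimately show ?thesis by simp
qed

text \<open>Independence splits the extended history, each factor gains its own transition
  probability, and independence joins the shorter histories again.\<close>

lemma prob_joint_history_Suc:
  assumes "\<And>s. s \<le> t \<Longrightarrow> x s < N" "\<And>s. s \<le> t \<Longrightarrow> y s < N" "i < N" "j < N"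
  shows "\<P>(\<omega> in M. (\<forall>s\<le>t. X s \<omega> = x s) \<and> (\<forall>s\<le>t. Y s \<omega> = y s) \<and> X (Suc t) \<omega> = i \<and> Y (Suc t) \<omega> = j) =
    \<P>(\<omega> in M. (\<forall>s\<le>t. X s \<omega> = x s) \<and> (\<forall>s\<le>t. Y s \<omega> = y s)) * (P $$ (x t, i) * P $$ (y t, j))"
proof -
  have eq: "(\<forall>s\<le>t. X s \<omega> = x s) \<and> (\<forall>s\<le>t. Y s \<omega> = y s) \<and> X (Suc t) \<omega> = i \<and> Y (Suc t) \<omega> = j \<longleftrightarrow>
      (\<forall>s\<le>Suc t. X s \<omega> = (x(Suc t := i)) s) \<and> (\<forall>s\<le>Suc t. Y s \<omega> = (y(Suc t := j)) s)" for \<omega>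
    by (auto simp: le_Suc_eq)
  show ?thesis
    unfolding eq prob_joint_history
    using assms by (simp add: prob_history_Suc[OF chain_X] prob_history_Suc[OF chain_Y] del: fun_upd_apply)
qed

text \<open>Equality of the positions is a countable union over the common value.\<close>

lemma measurable_meet [measurable]: "Measurable.pred M (\<lambda>\<omega>. X t \<omega> = Y t \<omega>)"
proof -
  have "Measurable.pred M (\<lambda>\<omega>. \<exists>n. X t \<omega> = n \<and> Y t \<omega> = n)"
    by measurable
  then show ?thesis by (simp add: eq_commute)
qed

section \<open>The pair walk before the meeting\<close>

definition apart :: "nat \<Rightarrow> 'w \<Rightarrow> bool" where
  "apart t \<omega> \<longleftrightarrow> (\<forall>s\<le>t. X s \<omega> \<noteq> Y s \<omega>)"

text \<open>The law of the pair at time \<open>t\<close> restricted to the event that no meeting has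
  occurred: a sub-probability whose missing mass has already met.\<close>

definition apart_prob :: "nat \<Rightarrow> nat \<Rightarrow> nat \<Rightarrow> real" where
  "apart_prob t i j = \<P>(\<omega> in M. apart t \<omega> \<and> X t \<omega> = i \<and> Y t \<omega> = j)"

lemma measurable_apart [measurable]: "Measurable.pred M (apart t)"
proof -
  have "Measurable.pred M (\<lambda>\<omega>. \<forall>s. s \<le> t \<longrightarrow> \<not> (X s \<omega> = Y s \<omega>))"
    by measurable
  then show ?thesis by (simp add: apart_def[abs_def])
qed

lemma apart_prob_nonneg: "apart_prob t i j \<ge> 0"
  by (simp add: apart_prob_def)

lemma apart_prob_diag [simp]: "apart_prob t i i = 0"
proof -
  have "{\<omega> \<in> space M. apart t \<omega> \<and> X t \<omega> = i \<and> Y t \<omega> = i} = {}"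
    by (auto simp: apart_def)
  then show ?thesis
    by (simp only: apart_prob_def measure_empty)
qed

text \<open>The Markov property is available for complete histories only. The event is therefore
  split into the finitely many joint histories that avoid a meeting and end in
  \<open>(i, j)\<close>; all of them carry the same transition factor.\<close>

lemma prob_apart_step:
  assumes ij: "i' < N" "j' < N"
  shows "\<P>(\<omega> in M. (apart t \<omega> \<and> X t \<omega> = i \<and> Y t \<omega> = j) \<and> X (Suc t) \<omega> = i' \<and> Y (Suc t) \<omega> = j') =
    apart_prob t i j * (P $$ (i, i') * P $$ (j, j'))"
proof -
  \<comment> \<open>Extensional functions make the set of histories finite and give each history
    exactly one representative.\<close>
  let ?paths = "PiE {..t} (\<lambda>_. {..<N})"
  define H where "H xy \<omega> \<longleftrightarrow> (\<forall>s\<le>t. X s \<omega> = fst xy s) \<and> (\<forall>s\<le>t. Y s \<omega> = snd xy s)" for xy \<omega>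
  have [measurable]: "Measurable.pred M (H xy)" for xy
    unfolding H_def[abs_def] by measurable
  define I where "I = {xy \<in> ?paths \<times> ?paths. (\<forall>s\<le>t. fst xy s \<noteq> snd xy s) \<and> fst xy t = i \<and> snd xy t = j}"
  have fin: "finite I"
  proof (rule finite_subset)
    show "I \<subseteq> ?paths \<times> ?paths"
      unfolding I_def by (rule Collect_restrict)
  qed (intro finite_cartesian_product finite_PiE; simp)
  have in_I: "H xy \<omega> \<Longrightarrow> xy \<in> I \<Longrightarrow> apart t \<omega> \<and> X t \<omega> = i \<and> Y t \<omega> = j" for xy \<omega>
    by (auto simp: I_def H_def apart_def)
  have unique: "\<exists>!xy\<in>I. H xy \<omega>" if "\<omega> \<in> space M" "apart t \<omega>" "X t \<omega> = i" "Y t \<omega> = j" for \<omega>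
  proof (rule ex1I[of _ "(restrict (\<lambda>s. X s \<omega>) {..t}, restrict (\<lambda>s. Y s \<omega>) {..t})"])
    show "(restrict (\<lambda>s. X s \<omega>) {..t}, restrict (\<lambda>s. Y s \<omega>) {..t}) \<in> I \<and>
      H (restrict (\<lambda>s. X s \<omega>) {..t}, restrict (\<lambda>s. Y s \<omega>) {..t}) \<omega>"
      using that chain_less by (auto simp: I_def H_def apart_def)
  next
    fix xy assume xy: "xy \<in> I \<and> H xy \<omega>"
    obtain x y where [simp]: "xy = (x, y)" by fastforce
    have "x = restrict (\<lambda>s. X s \<omega>) {..t}" "y = restrict (\<lambda>s. Y s \<omega>) {..t}"
      using xy by (auto simp: I_def H_def PiE_def extensional_def restrict_def fun_eq_iff)
    then show "xy = (restrict (\<lambda>s. X s \<omega>) {..t}, restrict (\<lambda>s. Y s \<omega>) {..t})" by simp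
  qed
  have "\<P>(\<omega> in M. (apart t \<omega> \<and> X t \<omega> = i \<and> Y t \<omega> = j) \<and> X (Suc t) \<omega> = i' \<and> Y (Suc t) \<omega> = j') =
      (\<Sum>xy\<in>I. \<P>(\<omega> in M. H xy \<omega> \<and> X (Suc t) \<omega> = i' \<and> Y (Suc t) \<omega> = j'))"
  proof (rule prob_sum[OF fin])
    show "AE \<omega> in M. (\<forall>xy\<in>I. H xy \<omega> \<and> X (Suc t) \<omega> = i' \<and> Y (Suc t) \<omega> = j' \<longrightarrow>
          (apart t \<omega> \<and> X t \<omega> = i \<and> Y t \<omega> = j) \<and> X (Suc t) \<omega> = i' \<and> Y (Suc t) \<omega> = j') \<and>
        ((apart t \<omega> \<and> X t \<omega> = i \<and> Y t \<omega> = j) \<and> X (Suc t) \<omega> = i' \<and> Y (Suc t) \<omega> = j' \<longrightarrow>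
          (\<exists>!xy\<in>I. H xy \<omega> \<and> X (Suc t) \<omega> = i' \<and> Y (Suc t) \<omega> = j'))"
      using in_I unique by (intro AE_I2) blast
  qed measurable
  also have "\<dots> = (\<Sum>xy\<in>I. \<P>(\<omega> in M. H xy \<omega>) * (P $$ (i, i') * P $$ (j, j')))"
  proof (rule sum.cong)
    fix xy assume "xy \<in> I"
    then have xy: "\<And>s. s \<le> t \<Longrightarrow> fst xy s < N" "\<And>s. s \<le> t \<Longrightarrow> snd xy s < N" "fst xy t = i" "snd xy t = j"
      by (auto simp: I_def PiE_def)
    show "\<P>(\<omega> in M. H xy \<omega> \<and> X (Suc t) \<omega> = i' \<and> Y (Suc t) \<omega> = j') =
      \<P>(\<omega> in M. H xy \<omega>) * (P $$ (i, i') * P $$ (j, j'))"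
      using prob_joint_history_Suc[of t "fst xy" "snd xy", OF xy(1,2) ij] unfolding H_def xy(3,4) by (simp only: conj_assoc)
  qed simp
  also have "\<dots> = (\<Sum>xy\<in>I. \<P>(\<omega> in M. H xy \<omega>)) * (P $$ (i, i') * P $$ (j, j'))"
    by (simp add: sum_distrib_right)
  also have "(\<Sum>xy\<in>I. \<P>(\<omega> in M. H xy \<omega>)) = apart_prob t i j"
    unfolding apart_prob_def
  proof (rule prob_sum[symmetric, OF fin])
    show "AE \<omega> in M. (\<forall>xy\<in>I. H xy \<omega> \<longrightarrow> apart t \<omega> \<and> X t \<omega> = i \<and> Y t \<omega> = j) \<and>
        (apart t \<omega> \<and> X t \<omega> = i \<and> Y t \<omega> = j \<longrightarrow> (\<exists>!xy\<in>I. H xy \<omega>))"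
      using in_I unique by (intro AE_I2) blast
  qed measurable
  finally show ?thesis .
qed

lemma prob_partition:
  assumes [measurable]: "Measurable.pred M Q"
  shows "\<P>(\<omega> in M. Q \<omega>) = (\<Sum>i<N. \<Sum>j<N. \<P>(\<omega> in M. Q \<omega> \<and> X t \<omega> = i \<and> Y t \<omega> = j))"
proof -
  have "\<P>(\<omega> in M. Q \<omega>) =
      (\<Sum>ij\<in>{..<N} \<times> {..<N}. \<P>(\<omega> in M. Q \<omega> \<and> X t \<omega> = fst ij \<and> Y t \<omega> = snd ij))"
  proof (rule prob_sum)
    show "AE \<omega> in M. (\<forall>ij\<in>{..<N} \<times> {..<N}. Q \<omega> \<and> X t \<omega> = fst ij \<and> Y t \<omega> = snd ij \<longrightarrow> Q \<omega>) \<and>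
      (Q \<omega> \<longrightarrow> (\<exists>!ij\<in>{..<N} \<times> {..<N}. Q \<omega> \<and> X t \<omega> = fst ij \<and> Y t \<omega> = snd ij))"
    proof (rule AE_I2, intro conjI ballI impI)
      fix \<omega> assume "\<omega> \<in> space M" "Q \<omega>"
      then show "\<exists>!ij\<in>{..<N} \<times> {..<N}. Q \<omega> \<and> X t \<omega> = fst ij \<and> Y t \<omega> = snd ij"
        using chain_less by (intro ex1I[of _ "(X t \<omega>, Y t \<omega>)"]) auto
    qed auto
  qed auto
  then show ?thesis
    by (simp add: sum.cartesian_product split_def)
qed

text \<open>The forward equation of the pair walk killed on the diagonal. At distinct positions,
  being apart up to \<open>Suc t\<close> is the same as being apart up to \<open>t\<close>, so the
  previous positions can be summed out.\<close>

lemma apart_prob_Suc: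
  assumes "i' < N" "j' < N" "i' \<noteq> j'"
  shows "apart_prob (Suc t) i' j' = (\<Sum>i<N. \<Sum>j<N. apart_prob t i j * (P $$ (i, i') * P $$ (j, j')))"
proof -
  have "apart_prob (Suc t) i' j' = \<P>(\<omega> in M. apart t \<omega> \<and> X (Suc t) \<omega> = i' \<and> Y (Suc t) \<omega> = j')"
    unfolding apart_prob_def using assms(3)
    by (intro arg_cong[where f = prob]) (auto simp: apart_def le_Suc_eq)
  also have "\<dots> = (\<Sum>i<N. \<Sum>j<N. \<P>(\<omega> in M.
      (apart t \<omega> \<and> X (Suc t) \<omega> = i' \<and> Y (Suc t) \<omega> = j') \<and> X t \<omega> = i \<and> Y t \<omega> = j))"
    by (rule prob_partition) measurable
  also have "\<dots> = (\<Sum>i<N. \<Sum>j<N. apart_prob t i j * (P $$ (i, i') * P $$ (j, j')))"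
    unfolding prob_apart_step[OF assms(1,2), symmetric]
    by (intro sum.cong refl arg_cong[where f = prob]) auto
  finally show ?thesis .
qed

lemma apart_prob_0:
  assumes "i < N" "j < N" "i \<noteq> j"
  shows "apart_prob 0 i j = 1 / (real N)\<^sup>2"
proof -
  have "apart_prob 0 i j = \<P>(\<omega> in M. (\<forall>s\<le>0. X s \<omega> = i) \<and> (\<forall>s\<le>0. Y s \<omega> = j))"
    unfolding apart_prob_def using assms(3)
    by (intro arg_cong[where f = prob]) (auto simp: apart_def)
  also have "\<dots> = \<P>(\<omega> in M. X 0 \<omega> = i) * \<P>(\<omega> in M. Y 0 \<omega> = j)"
    by (subst prob_joint_history) simp
  also have "\<dots> = 1 / (real N)\<^sup>2"
    using chain_X chain_Y assms by (simp add: uniform_markov_chain_def power2_eq_square)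
  finally show ?thesis .
qed

text \<open>On the event of a meeting, itself a countable union, the infimum is a
  \<open>LEAST\<close> over measurable predicates; elsewhere it is constant.\<close>

lemma measurable_meeting_time: "meeting_time X Y \<in> measurable M (count_space UNIV)"
proof -
  have "meeting_time X Y \<omega> =
      (if \<exists>t. X t \<omega> = Y t \<omega> then enat (LEAST t. X t \<omega> = Y t \<omega>) else \<infinity>)" for \<omega>
  proof (cases "\<exists>t. X t \<omega> = Y t \<omega>")
    case True
    then have "X (LEAST t. X t \<omega> = Y t \<omega>) \<omega> = Y (LEAST t. X t \<omega> = Y t \<omega>) \<omega>"
      by (rule LeastI_ex)
    with True show ?thesis
      unfolding meeting_time_def by (auto intro!: Inf_eqI intro: Least_le)
  qed (simp add: meeting_time_def top_enat_def)
  then have eq: "meeting_time X Y =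
      (\<lambda>\<omega>. if \<exists>t. X t \<omega> = Y t \<omega> then enat (LEAST t. X t \<omega> = Y t \<omega>) else \<infinity>)" ..
  show ?thesis
    unfolding eq
  proof (rule measurable_If)
    have "(\<lambda>\<omega>. LEAST t. X t \<omega> = Y t \<omega>) \<in> measurable M (count_space UNIV)"
      by measurable
    then show "(\<lambda>\<omega>. enat (LEAST t. X t \<omega> = Y t \<omega>)) \<in> measurable M (count_space UNIV)"
      by (rule measurable_compose) simp
    show "{\<omega> \<in> space M. \<exists>t. X t \<omega> = Y t \<omega>} \<in> events"
      by measurable
  qed simp
qed

text \<open>Finiteness of the expectation is a consequence: nonnegativity of \<open>G\<close> bounds
  the telescoping partial sums of the survival probabilities by \<open>H 0\<close>, so these
  probabilities tend to 0. Then \<open>H\<close> tends to 0 as well, and the whole series equals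
  \<open>H 0\<close>.\<close>

lemma expected_meeting_time_potential:
  assumes nonneg: "\<And>i j. i < N \<Longrightarrow> j < N \<Longrightarrow> G i j \<ge> 0"
    and diag: "\<And>i. i < N \<Longrightarrow> G i i = 0"
    and step: "\<And>i j. i < N \<Longrightarrow> j < N \<Longrightarrow> i \<noteq> j \<Longrightarrow>
      (\<Sum>i'<N. \<Sum>j'<N. P $$ (i, i') * P $$ (j, j') * G i' j') = G i j - 1"
  shows "expected_meeting_time M X Y = ennreal ((\<Sum>i<N. \<Sum>j<N. G i j) / (real N)\<^sup>2)"
proof -
  define surv where "surv t = \<P>(\<omega> in M. apart t \<omega>)" for t
  define H where "H t = (\<Sum>i<N. \<Sum>j<N. apart_prob t i j * G i j)" for t
  have surv: "surv t = (\<Sum>i<N. \<Sum>j<N. apart_prob t i j)" for t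
    unfolding surv_def apart_prob_def by (rule prob_partition) measurable
  have H_Suc: "H (Suc t) = H t - surv t" for t
  proof -
    let ?U = "\<lambda>i j i' j'. apart_prob t i j * (P $$ (i, i') * P $$ (j, j') * G i' j')"
    have "H (Suc t) = (\<Sum>i'<N. \<Sum>j'<N. \<Sum>i<N. \<Sum>j<N. ?U i j i' j')"
      unfolding H_def
    proof (intro sum.cong refl)
      fix i' j' assume "i' \<in> {..<N}" "j' \<in> {..<N}"
      \<comment> \<open>The forward equation fails on the diagonal, where mass is killed, but there
        \<open>G\<close> vanishes.\<close>
      then show "apart_prob (Suc t) i' j' * G i' j' = (\<Sum>i<N. \<Sum>j<N. ?U i j i' j')"
        by (cases "i' = j'") (simp_all add: diag apart_prob_Suc sum_distrib_right mult.assoc)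
    qed
    also have "\<dots> = (\<Sum>i'<N. \<Sum>i<N. \<Sum>j'<N. \<Sum>j<N. ?U i j i' j')"
      by (rule sum.cong[OF refl], rule sum.swap)
    also have "\<dots> = (\<Sum>i<N. \<Sum>i'<N. \<Sum>j'<N. \<Sum>j<N. ?U i j i' j')"
      by (rule sum.swap)
    also have "\<dots> = (\<Sum>i<N. \<Sum>i'<N. \<Sum>j<N. \<Sum>j'<N. ?U i j i' j')"
      by (rule sum.cong[OF refl], rule sum.cong[OF refl], rule sum.swap)
    also have "\<dots> = (\<Sum>i<N. \<Sum>j<N. \<Sum>i'<N. \<Sum>j'<N. ?U i j i' j')"
      by (rule sum.cong[OF refl], rule sum.swap)
    also have "\<dots> = (\<Sum>i<N. \<Sum>j<N. apart_prob t i j * G i j - apart_prob t i j)"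
    proof (intro sum.cong refl)
      fix i j assume "i \<in> {..<N}" "j \<in> {..<N}"
      \<comment> \<open>On the diagonal, where \<open>step\<close> gives nothing, the weight
        \<open>apart_prob t i j\<close> is 0.\<close>
      then show "(\<Sum>i'<N. \<Sum>j'<N. ?U i j i' j') = apart_prob t i j * G i j - apart_prob t i j"
        unfolding sum_distrib_left[symmetric]
        by (cases "i = j") (simp_all add: step right_diff_distrib)
    qed
    also have "\<dots> = H t - surv t"
      by (simp add: H_def surv sum_subtractf)
    finally show ?thesis .
  qed
  have partial: "(\<Sum>t<n. surv t) = H 0 - H n" for n
    by (induction n) (simp_all add: H_Suc)
  have "H n \<ge> 0" for n
    unfolding H_def using nonneg apart_prob_nonneg by (auto intro!: sum_nonneg mult_nonneg_nonneg)
  then have "summable surv"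
    by (intro summableI_nonneg_bounded[of _ "H 0"]) (simp_all only: partial, simp_all add: surv_def)
  then have "surv \<longlonglongrightarrow> 0"
    by (rule summable_LIMSEQ_zero)
  have apart_lim: "(\<lambda>t. apart_prob t i j) \<longlonglongrightarrow> 0" for i j
  proof (rule tendsto_sandwich[OF _ _ tendsto_const \<open>surv \<longlonglongrightarrow> 0\<close>])
    show "\<forall>\<^sub>F t in sequentially. apart_prob t i j \<le> surv t"
      unfolding apart_prob_def surv_def by (intro always_eventually allI finite_measure_mono) auto
  qed (simp add: apart_prob_nonneg)
  \<comment> \<open>There are finitely many pairs, so the limit may be taken term by term.\<close>
  have "H \<longlonglongrightarrow> (\<Sum>i<N. \<Sum>j<N. 0 * G i j)"
    unfolding H_def by (intro tendsto_sum tendsto_mult_right apart_lim)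
  then have "(\<lambda>n. H 0 - H n) \<longlonglongrightarrow> H 0 - 0"
    by (intro tendsto_diff tendsto_const) simp
  then have sums: "surv sums H 0"
    unfolding sums_def partial by simp
  have "expected_meeting_time M X Y = (\<Sum>t. emeasure M {\<omega> \<in> space M. enat t < meeting_time X Y \<omega>})"
    unfolding expected_meeting_time_def
    by (rule nn_integral_enat_function[OF measurable_meeting_time])
  also have "\<dots> = (\<Sum>t. ennreal (surv t))"
    unfolding meeting_time_gt_iff surv_def apart_def emeasure_eq_measure ..
  also have "\<dots> = ennreal (H 0)"
    by (rule suminf_ennreal_eq[OF _ sums]) (simp add: surv_def)
  also have "H 0 = (\<Sum>i<N. \<Sum>j<N. G i j / (real N)\<^sup>2)"
    unfolding H_def
  proof (intro sum.cong refl)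
    fix i j assume "i \<in> {..<N}" "j \<in> {..<N}"
    then show "apart_prob 0 i j * G i j = G i j / (real N)\<^sup>2"
      by (cases "i = j") (simp_all add: diag apart_prob_0)
  qed
  finally show ?thesis
    by (simp add: sum_divide_distrib)
qed

end

subsection \<open>The expected meeting time on the circle\<close>

(* nondeg fails exactly when, for some pair of starting vertices, the two walkers can never meet;
   the expected meeting time is then infinite while the sum is finite.

   The eigenvalues are taken over the complex numbers, where the characteristic polynomial always
   splits, so that the hypothesis eigenvalues can always be met. *)
theorem theorem1:
  fixes N :: nat and p1 p2 p3 :: real
    and M :: "'w measure" and X Y :: "nat \<Rightarrow> 'w \<Rightarrow> nat"
    and lam :: "nat \<Rightarrow> complex" and P :: "real mat"
  assumes N: "N \<ge> 1"
    and p: "p1 \<ge> 0" "p2 \<ge> 0" "p3 \<ge> 0" "p1 + p2 + p3 = 1"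
    and nondeg: "N = 1 \<or> (p1 < 1 \<and> p2 < 1 \<and> p3 < 1 \<and> (p3 > 0 \<or> odd N))"
    and P: "P = circle_walk_matrix N p1 p2 p3"
    and eigenvalues:
      "char_poly (map_mat complex_of_real (circle_laplacian N P)) = (\<Prod>i<N. [:- lam i, 1:])"
    and M: "prob_space M"
    and X: "uniform_markov_chain M N P X"
    and Y: "uniform_markov_chain M N P Y"
    and indep: "independent_walks M N X Y"
  shows "expected_meeting_time M X Y < \<infinity> \<and>
    complex_of_real (enn2real (expected_meeting_time M X Y)) =
      (\<Sum>i\<in>{i. i < N \<and> lam i \<noteq> 0}. inverse (lam i))"
proof -
  interpret independent_chains M N P X Y
    using M X Y indep by (simp add: independent_chains_def independent_chains_axioms_def)
  let ?l = "walk_eigenvalue N p1 p2 p3"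
  \<comment> \<open>For \<open>N = 1\<close> no such \<open>k\<close> exists, which settles the
    first alternative of \<open>nondeg\<close>.\<close>
  have pos: "?l k > 0" if "0 < k" "k < N" for k
    using walk_eigenvalue_pos[OF p] nondeg that by auto
  let ?S = "\<Sum>k=1..<N. 1 / ?l k"
  have "expected_meeting_time M X Y =
      ennreal ((\<Sum>i<N. \<Sum>j<N. meeting_potential N p1 p2 p3 i j) / (real N)\<^sup>2)"
  proof (rule expected_meeting_time_potential)
    show "meeting_potential N p1 p2 p3 i j \<ge> 0" for i j
      by (rule meeting_potential_nonneg) (rule pos)
    show "(\<Sum>i'<N. \<Sum>j'<N. P $$ (i, i') * P $$ (j, j') * meeting_potential N p1 p2 p3 i' j') =
        meeting_potential N p1 p2 p3 i j - 1" if "i < N" "j < N" "i \<noteq> j" for i j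
      unfolding P using N that p(4) pos by (rule meeting_potential_step)
  qed (rule meeting_potential_diag)
  also have "\<dots> = ennreal ?S"
    using N by (simp add: sum_meeting_potential[OF N])
  finally have E: "expected_meeting_time M X Y = ennreal ?S" .
  have S_nonneg: "?S \<ge> 0"
    using pos by (intro sum_nonneg) (simp add: less_imp_le)
  have "(\<Prod>i<N. [:- lam i, 1:]) = (\<Prod>k<N. [:- complex_of_real (?l k), 1:])"
    unfolding eigenvalues[symmetric] P by (rule char_poly_circle_laplacian[OF N])
  then have "(\<Sum>i<N. inverse (lam i)) = (\<Sum>k<N. inverse (complex_of_real (?l k)))"
    by (rule linear_factors_sum_eq[where a = lam])
  also have "\<dots> = complex_of_real (\<Sum>k<N. inverse (?l k))"
    by simp
  \<comment> \<open>The term of frequency 0 drops out because its eigenvalue is 0 and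
    \<open>inverse 0 = 0\<close>.\<close>
  also have "(\<Sum>k<N. inverse (?l k)) = ?S"
    using sum_lessThan_shift1[OF N, of "\<lambda>k. inverse (?l k)"]
    by (simp add: walk_eigenvalue_0[OF p(4)] inverse_eq_divide)
  finally have lam: "(\<Sum>i<N. inverse (lam i)) = complex_of_real ?S" .
  \<comment> \<open>The same default value \<open>inverse 0 = 0\<close> makes the restriction to
    nonzero eigenvalues harmless.\<close>
  have "(\<Sum>i\<in>{i. i < N \<and> lam i \<noteq> 0}. inverse (lam i)) = (\<Sum>i<N. inverse (lam i))"
    by (rule sum.mono_neutral_left) auto
  then show ?thesis
    unfolding E lam using S_nonneg by simp
qed

end
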